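(* Every lexicographically edge-ordered graph $\mathfrak{G}=(G,\prec)$ with vertex set $V$ satisfies \[\overline{R}_{lex}(\mathfrak{G}) \leq \min_f \overline{R}(\mathcal{G}_f),\] where the minimum is taken over all one-to-one correspondences $f\colon V \to \{1,\dots,|V|\}$ that are consistent with the lexicographic edge-ordering $\prec$, and $\mathcal{G}_f$ is the vertex-ordering of $G$ determined by $f$ (that is, $u$ precedes $v$ in $\mathcal{G}_f$ if and only if $f(u)<f(v)$).
   Context: All graphs are finite and simple. An edge-ordered graph $(G,\prec)$ is a graph $G$ with a linear ordering $\prec$ of its edges. $(G,\prec_1)$ is an edge-ordered subgraph of $(H,\prec_2)$ if $G$ is a (not necessarily induced) subgraph of $H$ and $\prec_1$ is a suborder of $\prec_2$. A vertex-ordered graph (ordered graph) $\mathcal{G}=(G,<)$ is a graph with a linear ordering of its vertices, also called a vertex-ordering of $G$; $(G,<_1)$ is a vertex-ordered subgraph of $(H,<_2)$ if $G$ is a subgraph of $H$ and $<_1$ is a suborder of $<_2$. In both settings isomorphisms are graph isomorphisms preserving the given orderings, and a copy of an ordered structure is a sub-structure (edge-ordered, resp. vertex-ordered, subgraph) isomorphic to it; it is monochromatic if all its edges have the same color. An ordering $\prec$ of the edges of a graph $G=(V,E)$ is lexicographic if there is a one-to-one correspondence $f\colon V\to\{1,\dots,|V|\}$ such that any two edges $\{u,v\}$ and $\{w,t\}$ of $G$ with $f(u)<f(v)$ and $f(w)<f(t)$ satisfy $\{u,v\}\prec\{w,t\}$ if either $f(u)<f(w)$, or $f(u)=f(w)$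 and $f(v)<f(t)$. Such an $f$ is said to be consistent with $\prec$ (it need not be unique). A graph with a lexicographic edge-ordering is called lexicographically edge-ordered. Up to isomorphism there is a unique lexicographic edge-ordering $\mathfrak{K}^{lex}_N$ of the complete graph $K_N$, and a unique vertex-ordering $\mathcal{K}_N$ of $K_N$. The lexicographic edge-ordered Ramsey number $\overline{R}_{lex}(\mathfrak{G})$ of a lexicographically edge-ordered graph $\mathfrak{G}$ is the minimum $N$ such that every 2-coloring of the edges of $\mathfrak{K}^{lex}_N$ contains a monochromatic copy of $\mathfrak{G}$ as an edge-ordered subgraph. The ordered Ramsey number $\overline{R}(\mathcal{G})$ of a vertex-ordered graph $\mathcal{G}$ is the minimum positive integer $N$ such that every 2-coloring of the edges of $\mathcal{K}_N$ contains a monochromatic copy of $\mathcal{G}$ as a vertex-ordered subgraph. *)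

theory Defs
  imports Main "HOL-Library.FuncSet" "HOL-Library.Ramsey"
begin

record 'a graph =
  verts :: "'a set"
  edges :: "'a set set"

record 'a eo_graph = "'a graph" +
  eord :: "'a set rel"

record 'a vo_graph = "'a graph" +
  vord :: "'a rel"

text \<open>The predicates and operations on plain graphs are stated on the record scheme, so that they
  apply to edge-ordered and vertex-ordered graphs alike. All orderings are strict.\<close>

definition simple_graph :: "('a, 'x) graph_scheme \<Rightarrow> bool" where
  "simple_graph G \<longleftrightarrow> finite (verts G) \<and> edges G \<subseteq> [verts G]\<^bsup>2\<^esup>"

definition edge_ordered_graph :: "'a eo_graph \<Rightarrow> bool" where
  "edge_ordered_graph G \<longleftrightarrow>
     simple_graph G \<and> eord G \<subseteq> edges G \<times> edges G \<and> strict_linear_order_on (edges G) (eord G)"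

definition vertex_ordered_graph :: "'a vo_graph \<Rightarrow> bool" where
  "vertex_ordered_graph G \<longleftrightarrow>
     simple_graph G \<and> vord G \<subseteq> verts G \<times> verts G \<and> strict_linear_order_on (verts G) (vord G)"

definition subgraph :: "('a, 'x) graph_scheme \<Rightarrow> ('a, 'y) graph_scheme \<Rightarrow> bool" where
  "subgraph G H \<longleftrightarrow>
     simple_graph G \<and> simple_graph H \<and> verts G \<subseteq> verts H \<and> edges G \<subseteq> edges H"

definition eo_subgraph :: "'a eo_graph \<Rightarrow> 'a eo_graph \<Rightarrow> bool" where
  "eo_subgraph G H \<longleftrightarrow> subgraph G H \<and> eord G = Restr (eord H) (edges G)"

definition vo_subgraph :: "'a vo_graph \<Rightarrow> 'a vo_graph \<Rightarrow> bool" where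
  "vo_subgraph G H \<longleftrightarrow> subgraph G H \<and> vord G = Restr (vord H) (verts G)"

definition graph_iso :: "('a \<Rightarrow> 'b) \<Rightarrow> ('a, 'x) graph_scheme \<Rightarrow> ('b, 'y) graph_scheme \<Rightarrow> bool" where
  "graph_iso \<phi> G H \<longleftrightarrow> bij_betw \<phi> (verts G) (verts H) \<and>
     (\<forall>u\<in>verts G. \<forall>v\<in>verts G. {u, v} \<in> edges G \<longleftrightarrow> {\<phi> u, \<phi> v} \<in> edges H)"

definition eo_iso :: "('a \<Rightarrow> 'b) \<Rightarrow> 'a eo_graph \<Rightarrow> 'b eo_graph \<Rightarrow> bool" where
  "eo_iso \<phi> G H \<longleftrightarrow> graph_iso \<phi> G H \<and>
     (\<forall>e\<in>edges G. \<forall>e'\<in>edges G. (e, e') \<in> eord G \<longleftrightarrow> (\<phi> ` e, \<phi> ` e') \<in> eord H)"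

definition vo_iso :: "('a \<Rightarrow> 'b) \<Rightarrow> 'a vo_graph \<Rightarrow> 'b vo_graph \<Rightarrow> bool" where
  "vo_iso \<phi> G H \<longleftrightarrow> graph_iso \<phi> G H \<and>
     (\<forall>u\<in>verts G. \<forall>v\<in>verts G. (u, v) \<in> vord G \<longleftrightarrow> (\<phi> u, \<phi> v) \<in> vord H)"

definition eo_copy :: "'b eo_graph \<Rightarrow> 'a eo_graph \<Rightarrow> 'b eo_graph \<Rightarrow> bool" where
  "eo_copy C G H \<longleftrightarrow> eo_subgraph C H \<and> (\<exists>\<phi>. eo_iso \<phi> G C)"

definition vo_copy :: "'b vo_graph \<Rightarrow> 'a vo_graph \<Rightarrow> 'b vo_graph \<Rightarrow> bool" where
  "vo_copy C G H \<longleftrightarrow> vo_subgraph C H \<and> (\<exists>\<phi>. vo_iso \<phi> G C)"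

text \<open>A 2-coloring of the edges is a map \<open>col\<close> into \<^typ>\<open>bool\<close>; its values outside the edge set are
  irrelevant.\<close>

definition monochromatic :: "('a set \<Rightarrow> bool) \<Rightarrow> ('a, 'x) graph_scheme \<Rightarrow> bool" where
  "monochromatic col G \<longleftrightarrow> (\<exists>c. \<forall>e\<in>edges G. col e = c)"

text \<open>Membership in the extensional function space makes \<open>f\<close> a genuine function on the vertex set,
  so that a finite graph has only finitely many consistent \<open>f\<close>.\<close>

definition consistent :: "('a \<Rightarrow> nat) \<Rightarrow> 'a eo_graph \<Rightarrow> bool" where
  "consistent f G \<longleftrightarrow>
     f \<in> verts G \<rightarrow>\<^sub>E {1..card (verts G)} \<and> bij_betw f (verts G) {1..card (verts G)} \<and>
     (\<forall>u v w t. {u, v} \<in> edges G \<longrightarrow> {w, t} \<in> edges G \<longrightarrow> f u < f v \<longrightarrow> f w < f t \<longrightarrow>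
        f u < f w \<or> f u = f w \<and> f v < f t \<longrightarrow> ({u, v}, {w, t}) \<in> eord G)"

definition lex_edge_ordered_graph :: "'a eo_graph \<Rightarrow> bool" where
  "lex_edge_ordered_graph G \<longleftrightarrow> edge_ordered_graph G \<and> (\<exists>f. consistent f G)"

definition vo_graph_of :: "'a eo_graph \<Rightarrow> ('a \<Rightarrow> nat) \<Rightarrow> 'a vo_graph" where
  "vo_graph_of G f = \<lparr>verts = verts G, edges = edges G,
     vord = {(u, v). u \<in> verts G \<and> v \<in> verts G \<and> f u < f v}\<rparr>"

definition K_lex :: "nat \<Rightarrow> nat eo_graph" where
  "K_lex N = \<lparr>verts = {1..N}, edges = [{1..N}]\<^bsup>2\<^esup>,
     eord = {({u, v}, {w, t}) | u v w t. {u, v, w, t} \<subseteq> {1..N} \<and> u < v \<and> w < t \<and>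
               (u < w \<or> u = w \<and> v < t)}\<rparr>"

definition K_ord :: "nat \<Rightarrow> nat vo_graph" where
  "K_ord N = \<lparr>verts = {1..N}, edges = [{1..N}]\<^bsup>2\<^esup>,
     vord = {(u, v). u \<in> {1..N} \<and> v \<in> {1..N} \<and> u < v}\<rparr>"

text \<open>By Ramsey's theorem the minima below are over nonempty sets, for lexicographically
  edge-ordered and for vertex-ordered \<open>G\<close>, respectively.\<close>

definition lex_ramsey_number :: "'a eo_graph \<Rightarrow> nat" where
  "lex_ramsey_number G = (LEAST N. N > 0 \<and>
     (\<forall>col :: nat set \<Rightarrow> bool. \<exists>C. eo_copy C G (K_lex N) \<and> monochromatic col C))"

definition ordered_ramsey_number :: "'a vo_graph \<Rightarrow> nat" where
  "ordered_ramsey_number G = (LEAST N. N > 0 \<and>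
     (\<forall>col :: nat set \<Rightarrow> bool. \<exists>C. vo_copy C G (K_ord N) \<and> monochromatic col C))"

lemma finite_consistent: "edge_ordered_graph G \<Longrightarrow> finite {f. consistent f G}"
  by (rule finite_subset[of _ "verts G \<rightarrow>\<^sub>E {1..card (verts G)}"])
    (auto simp: consistent_def edge_ordered_graph_def simple_graph_def intro: finite_PiE)

lemma K_ord_vertex_ordered: "vertex_ordered_graph (K_ord N)"
  by (auto simp: K_ord_def vertex_ordered_graph_def simple_graph_def strict_linear_order_on_def
      trans_def irrefl_def total_on_def)

lemma K_lex_eord_iff:
  assumes "a < b" "c < d"
  shows "({a, b}, {c, d}) \<in> eord (K_lex N) \<longleftrightarrow>
     {a, b, c, d} \<subseteq> {1..N} \<and> (a < c \<or> a = c \<and> b < d)"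
proof
  assume "({a, b}, {c, d}) \<in> eord (K_lex N)"
  then show "{a, b, c, d} \<subseteq> {1..N} \<and> (a < c \<or> a = c \<and> b < d)"
    using assms unfolding K_lex_def by (auto simp: doubleton_eq_iff)
next
  assume "{a, b, c, d} \<subseteq> {1..N} \<and> (a < c \<or> a = c \<and> b < d)"
  then show "({a, b}, {c, d}) \<in> eord (K_lex N)"
    using assms unfolding K_lex_def eo_graph.simps mem_Collect_eq by blast
qed

lemma K_lex_edgeE:
  assumes "e \<in> edges (K_lex N)"
  obtains a b where "e = {a, b}" "a < b" "a \<in> {1..N}" "b \<in> {1..N}"
proof -
  obtain a b where "e = {a, b}" "a \<noteq> b" "e \<subseteq> {1..N}"
    using assms by (auto simp: K_lex_def nsets_def card_2_iff)
  then show ?thesis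
    using that[of a b] that[of b a] by (cases "a < b") (auto simp: insert_commute)
qed

lemma K_lex_eord_subset: "eord (K_lex N) \<subseteq> edges (K_lex N) \<times> edges (K_lex N)"
  by (auto simp: K_lex_def nsets_def card_insert_if)

lemma K_lex_edge_ordered: "edge_ordered_graph (K_lex N)"
proof -
  have "trans (eord (K_lex N))"
  proof (rule transI)
    fix x y z assume xy: "(x, y) \<in> eord (K_lex N)" and yz: "(y, z) \<in> eord (K_lex N)"
    then have "x \<in> edges (K_lex N)" "y \<in> edges (K_lex N)" "z \<in> edges (K_lex N)"
      using K_lex_eord_subset by auto
    obtain a b where "x = {a, b}" "a < b" using \<open>x \<in> edges (K_lex N)\<close> by (rule K_lex_edgeE)
    moreover obtain c d where "y = {c, d}" "c < d" using \<open>y \<in> edges (K_lex N)\<close> by (rule K_lex_edgeE)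
    moreover obtain p q where "z = {p, q}" "p < q" using \<open>z \<in> edges (K_lex N)\<close> by (rule K_lex_edgeE)
    ultimately show "(x, z) \<in> eord (K_lex N)" using xy yz by (auto simp: K_lex_eord_iff)
  qed
  moreover have "irrefl (eord (K_lex N))"
  proof (rule irreflI)
    fix x show "(x, x) \<notin> eord (K_lex N)"
    proof
      assume xx: "(x, x) \<in> eord (K_lex N)"
      then have "x \<in> edges (K_lex N)" using K_lex_eord_subset by auto
      then obtain a b where "x = {a, b}" "a < b" by (rule K_lex_edgeE)
      then show False using xx by (simp add: K_lex_eord_iff)
    qed
  qed
  moreover have "total_on (edges (K_lex N)) (eord (K_lex N))"
  proof (rule total_onI)
    fix x y assume "x \<in> edges (K_lex N)" "y \<in> edges (K_lex N)" and ne: "x \<noteq> y"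
    obtain a b where x: "x = {a, b}" "a < b" "a \<in> {1..N}" "b \<in> {1..N}"
      using \<open>x \<in> edges (K_lex N)\<close> by (rule K_lex_edgeE)
    obtain c d where y: "y = {c, d}" "c < d" "c \<in> {1..N}" "d \<in> {1..N}"
      using \<open>y \<in> edges (K_lex N)\<close> by (rule K_lex_edgeE)
    have "\<not> (a = c \<and> b = d)" using ne x(1) y(1) by auto
    then have "a < c \<or> a = c \<and> b < d \<or> c < a \<or> c = a \<and> d < b" by linarith
    moreover have "(x, y) \<in> eord (K_lex N) \<longleftrightarrow> a < c \<or> a = c \<and> b < d"
      unfolding x(1) y(1) K_lex_eord_iff[OF x(2) y(2)] using x y by simp
    moreover have "(y, x) \<in> eord (K_lex N) \<longleftrightarrow> c < a \<or> c = a \<and> d < b"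
      unfolding x(1) y(1) K_lex_eord_iff[OF y(2) x(2)] using x y by simp
    ultimately show "(x, y) \<in> eord (K_lex N) \<or> (y, x) \<in> eord (K_lex N)" by blast
  qed
  ultimately show ?thesis
    using K_lex_eord_subset
    by (auto simp: edge_ordered_graph_def strict_linear_order_on_def simple_graph_def K_lex_def)
qed

lemma K_lex_lexicographic: "lex_edge_ordered_graph (K_lex N)"
proof -
  have "consistent (restrict id {1..N}) (K_lex N)"
    unfolding consistent_def
  proof (intro conjI allI impI)
    show "bij_betw (restrict id {1..N}) (verts (K_lex N)) {1..card (verts (K_lex N))}"
      by (simp add: K_lex_def bij_betw_def inj_on_def)
    fix u v w t :: nat
    assume "{u, v} \<in> edges (K_lex N)" "{w, t} \<in> edges (K_lex N)"
    then have "{u, v, w, t} \<subseteq> {1..N}" by (auto simp: K_lex_def nsets_def)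
    moreover assume "restrict id {1..N} u < restrict id {1..N} v"
      "restrict id {1..N} w < restrict id {1..N} t"
      "restrict id {1..N} u < restrict id {1..N} w \<or>
       restrict id {1..N} u = restrict id {1..N} w \<and> restrict id {1..N} v < restrict id {1..N} t"
    ultimately show "({u, v}, {w, t}) \<in> eord (K_lex N)"
      by (simp add: K_lex_eord_iff)
  qed (auto simp: K_lex_def)
  then show ?thesis
    using K_lex_edge_ordered by (auto simp: lex_edge_ordered_graph_def)
qed

end

theory Submission imports Defs "HOL-Library.Infinite_Set" begin

text \<open>If \<open>f\<close> is consistent with the lexicographic edge-ordering of \<open>G\<close>, that ordering is determined
  by \<open>f\<close>, so a vertex-order-preserving embedding of \<open>G\<close> into \<open>K\<^sub>N\<close> also preserves the lexicographic
  edge-orderings. Hence every \<open>N\<close> that is Ramsey for the vertex-ordered graph is Ramsey for \<open>G\<close>.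
  Ramsey's theorem guarantees that the least such \<open>N\<close> is attained.\<close>

text \<open>Consistency supplies only the implication from right to left. For the converse,
  linearity of the order on the naturals leaves two cases: a reversed comparison would give a cycle
  in \<open>eord G\<close>, and equal labels force equal edges by injectivity of \<open>f\<close>,
  against irreflexivity.\<close>

lemma consistent_eord_iff:
  assumes G: "edge_ordered_graph G" and f: "consistent f G"
    and e: "{u, v} \<in> edges G" "{w, t} \<in> edges G" "f u < f v" "f w < f t"
  shows "({u, v}, {w, t}) \<in> eord G \<longleftrightarrow> f u < f w \<or> f u = f w \<and> f v < f t"
proof
  assume *: "({u, v}, {w, t}) \<in> eord G"
  have irrefl: "irrefl (eord G)" and trans: "trans (eord G)"
    using G by (auto simp: edge_ordered_graph_def strict_linear_order_on_def)
  have inj: "inj_on f (verts G)"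
    using f by (auto simp: consistent_def bij_betw_def)
  have V: "u \<in> verts G" "v \<in> verts G" "w \<in> verts G" "t \<in> verts G"
    using G e by (auto simp: edge_ordered_graph_def simple_graph_def nsets_def)
  show "f u < f w \<or> f u = f w \<and> f v < f t"
  proof (rule ccontr)
    assume "\<not> ?thesis"
    then consider "f w < f u \<or> f w = f u \<and> f t < f v" | "f w = f u" "f t = f v"
      by linarith
    then show False
    proof cases
      case 1
      then have "({w, t}, {u, v}) \<in> eord G"
        using f e unfolding consistent_def by blast
      then show False
        using * irrefl trans by (meson irreflD transD)
    next
      case 2
      then have "w = u" "t = v"
        using inj V by (auto dest: inj_onD)
      then show False
        using * irrefl by (auto dest: irreflD)
    qed
  qed
next
  assume "f u < f w \<or> f u = f w \<and> f v < f t"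
  then show "({u, v}, {w, t}) \<in> eord G"
    using f e unfolding consistent_def by blast
qed

lemma consistent_edgeE:
  assumes G: "edge_ordered_graph G" and f: "consistent f G" and e: "e \<in> edges G"
  obtains u v where "e = {u, v}" "u \<in> verts G" "v \<in> verts G" "f u < f v"
proof -
  have "e \<in> [verts G]\<^bsup>2\<^esup>"
    using G e by (auto simp: edge_ordered_graph_def simple_graph_def)
  then obtain u v where uv: "e = {u, v}" "u \<in> verts G" "v \<in> verts G" "u \<noteq> v"
    by (rule nsets2_E)
  have "f u \<noteq> f v"
    using f uv by (auto simp: consistent_def bij_betw_def dest: inj_onD)
  then show ?thesis
    using that[of u v] that[of v u] uv by (cases "f u < f v") (auto simp: insert_commute)
qed

text \<open>Both edge-orderings are the same lexicographic comparison, in terms of \<open>f\<close>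
  on \<open>G\<close> and of the vertices themselves in \<open>K_lex N\<close>, and an
  order-preserving \<open>\<phi>\<close> translates one into the other. The new copy keeps the edges
  of \<open>C\<close>, so a monochromatic \<open>C\<close> yields a monochromatic copy.\<close>

lemma vo_copy_imp_eo_copy:
  assumes G: "edge_ordered_graph G" and f: "consistent f G"
    and C: "vo_copy C (vo_graph_of G f) (K_ord N)"
  shows "eo_copy \<lparr>verts = verts C, edges = edges C, eord = Restr (eord (K_lex N)) (edges C)\<rparr> G (K_lex N)"
    (is "eo_copy ?D _ _")
proof -
  obtain \<phi> where sub: "vo_subgraph C (K_ord N)" and iso: "vo_iso \<phi> (vo_graph_of G f) C"
    using C by (auto simp: vo_copy_def)
  have "eo_subgraph ?D (K_lex N)"
    using sub by (auto simp: eo_subgraph_def vo_subgraph_def subgraph_def simple_graph_def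
        K_lex_def K_ord_def)
  moreover have "eo_iso \<phi> G ?D"
    unfolding eo_iso_def
  proof (intro conjI ballI)
    show "graph_iso \<phi> G ?D"
      using iso by (simp add: vo_iso_def graph_iso_def vo_graph_of_def)
    have im: "\<phi> v \<in> verts C" if "v \<in> verts G" for v
      using iso that by (auto simp: vo_iso_def graph_iso_def vo_graph_of_def bij_betw_def)
    have V: "verts C \<subseteq> {1..N}"
      using sub by (auto simp: vo_subgraph_def subgraph_def K_ord_def)
    have less: "f u < f v \<longleftrightarrow> \<phi> u < \<phi> v" if "u \<in> verts G" "v \<in> verts G" for u v
    proof -
      have "f u < f v \<longleftrightarrow> (\<phi> u, \<phi> v) \<in> vord C"
        using iso that by (simp add: vo_iso_def vo_graph_of_def)
      then show ?thesis
        using sub im[OF that(1)] im[OF that(2)] V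
        by (auto simp: vo_subgraph_def K_ord_def)
    qed
    have edge: "{\<phi> u, \<phi> v} \<in> edges C" if "u \<in> verts G" "v \<in> verts G" "{u, v} \<in> edges G" for u v
      using iso that by (simp add: vo_iso_def graph_iso_def vo_graph_of_def)
    \<comment> \<open>Equality means that neither side is smaller, so it transfers by
      \<open>less\<close> in both directions; it is needed for edges with a common first
      endpoint.\<close>
    have inj: "f u = f v \<longleftrightarrow> \<phi> u = \<phi> v" if "u \<in> verts G" "v \<in> verts G" for u v
      using less[OF that] less[OF that(2,1)] by linarith
    fix e e' assume e: "e \<in> edges G" and e': "e' \<in> edges G"
    obtain u v where uv: "e = {u, v}" "u \<in> verts G" "v \<in> verts G" "f u < f v"
      using consistent_edgeE[OF G f e] .
    obtain w t where wt: "e' = {w, t}" "w \<in> verts G" "t \<in> verts G" "f w < f t"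
      using consistent_edgeE[OF G f e'] .
    have lt: "\<phi> u < \<phi> v" "\<phi> w < \<phi> t"
      using uv wt less[of u v] less[of w t] by simp_all
    have "(e, e') \<in> eord G \<longleftrightarrow> f u < f w \<or> f u = f w \<and> f v < f t"
      using consistent_eord_iff[OF G f, of u v w t] e e' uv wt by simp
    also have "\<dots> \<longleftrightarrow> \<phi> u < \<phi> w \<or> \<phi> u = \<phi> w \<and> \<phi> v < \<phi> t"
      using less[OF uv(2) wt(2)] inj[OF uv(2) wt(2)] less[OF uv(3) wt(3)] by simp
    also have "\<dots> \<longleftrightarrow> ({\<phi> u, \<phi> v}, {\<phi> w, \<phi> t}) \<in> eord (K_lex N)"
      using K_lex_eord_iff[OF lt] im[OF uv(2)] im[OF uv(3)] im[OF wt(2)] im[OF wt(3)] V by auto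
    also have "\<dots> \<longleftrightarrow> (\<phi> ` e, \<phi> ` e') \<in> eord ?D"
      using edge[OF uv(2,3)] edge[OF wt(2,3)] e e' uv(1) wt(1) by simp
    finally show "(e, e') \<in> eord G \<longleftrightarrow> (\<phi> ` e, \<phi> ` e') \<in> eord ?D" .
  qed
  ultimately show ?thesis
    by (auto simp: eo_copy_def)
qed

text \<open>This is Ramsey's theorem for two colors, moved from \<open>{..<N}\<close> to the vertex
  set \<open>{1..N}\<close>. The \<open>Suc\<close> in the bound makes positivity immediate.\<close>

lemma ex_monochromatic_clique:
  obtains N where "N > 0"
    "\<And>col :: nat set \<Rightarrow> bool. \<exists>H c. H \<subseteq> {1..N} \<and> card H = m \<and> (\<forall>e\<in>[H]\<^bsup>2\<^esup>. col e = c)"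
proof -
  have P: "partn_lst {..<Suc (ES 2 m m)} [m, m] 2" (is "partn_lst {..<?N} _ _")
    by (rule partn_lst_greater_resource[OF ramsey2_full]) simp
  have "\<exists>H c. H \<subseteq> {1..?N} \<and> card H = m \<and> (\<forall>e\<in>[H]\<^bsup>2\<^esup>. col e = c)" for col :: "nat set \<Rightarrow> bool"
  proof -
    \<comment> \<open>The coloring is pulled back along the shift \<open>Suc\<close>, with the
      booleans coded as the colors 0 and 1 that \<open>partn_lst\<close> expects.\<close>
    define g :: "nat set \<Rightarrow> nat" where "g X = of_bool (col (Suc ` X))" for X
    have "g \<in> [{..<?N}]\<^bsup>2\<^esup> \<rightarrow> {..<2}"
      by (auto simp: g_def)
    then obtain i H where H: "i < 2" "H \<in> [{..<?N}]\<^bsup>([m, m] ! i)\<^esup>" "g ` [H]\<^bsup>2\<^esup> \<subseteq> {i}"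
      using partn_lstE[OF P, of g 2] by (metis length_Cons list.size(3) numeral_2_eq_2)
    then have H': "H \<subseteq> {..<?N}" "card H = m"
      by (auto simp: nsets_def less_2_cases_iff)
    have "col e = (i = 1)" if e: "e \<in> [Suc ` H]\<^bsup>2\<^esup>" for e
    proof -
      obtain X where "X \<in> [H]\<^bsup>2\<^esup>" "e = Suc ` X"
        using nset_image_obtains[OF e] by auto
      then show ?thesis
        using H(3) by (cases "col e") (auto simp: g_def image_subset_iff)
    qed
    moreover have "Suc ` H \<subseteq> {1..?N}" "card (Suc ` H) = m"
      using H' by (auto simp: card_image)
    ultimately show ?thesis
      by blast
  qed
  then show ?thesis
    using that[of ?N] by simp
qed

text \<open>In a complete graph any set of the right size hosts a copy: the vertices of
  \<open>G\<close>, listed by increasing \<open>f\<close>, go to the elements of \<open>H\<close> in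
  increasing order. All edges of the copy lie inside \<open>H\<close>, so a monochromatic
  \<open>H\<close> gives a monochromatic copy.\<close>

lemma vo_copy_on_subset:
  assumes G: "simple_graph G"
    and f: "bij_betw f (verts G) {1..card (verts G)}"
    and H: "H \<subseteq> {1..N}" "card H = card (verts G)"
  obtains C where "vo_copy C (vo_graph_of G f) (K_ord N)" "edges C \<subseteq> [H]\<^bsup>2\<^esup>"
proof -
  let ?m = "card (verts G)"
  have "finite H"
    using H finite_subset by blast
  then obtain h where h: "bij_betw h {..<?m} H" "strict_mono_on {..<?m} h"
    using ex_bij_betw_strict_mono_card[of H] H(2) by metis
  \<comment> \<open>Labels \<open>f v\<close> start at 1 while \<open>h\<close> enumerates
    \<open>H\<close> from index 0. The truncated subtraction is harmless because \<open>f v\<close>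
    is at least 1 on the vertices.\<close>
  define \<phi> where "\<phi> v = h (f v - 1)" for v
  have f_in: "1 \<le> f v" "f v \<le> ?m" if "v \<in> verts G" for v
    using bij_betwE[OF f] that by auto
  have less: "\<phi> u < \<phi> v \<longleftrightarrow> f u < f v" if "u \<in> verts G" "v \<in> verts G" for u v
  proof -
    have "\<phi> u < \<phi> v \<longleftrightarrow> f u - 1 < f v - 1"
      unfolding \<phi>_def using f_in[OF that(1)] f_in[OF that(2)]
      by (intro strict_mono_on_less[OF h(2)]) auto
    then show ?thesis
      using f_in[OF that(1)] f_in[OF that(2)] by linarith
  qed
  have "inj_on f (verts G)"
    using f by (simp add: bij_betw_def)
  have inj: "inj_on \<phi> (verts G)"
  proof (rule inj_onI)
    fix u v assume uv: "u \<in> verts G" "v \<in> verts G" "\<phi> u = \<phi> v"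
    then have "f u = f v"
      using less[of u v] less[of v u] by simp
    then show "u = v"
      using \<open>inj_on f (verts G)\<close> uv by (auto dest: inj_onD)
  qed
  have im: "\<phi> \<in> verts G \<rightarrow> H"
  proof
    fix v assume "v \<in> verts G"
    then have "f v - 1 \<in> {..<?m}"
      using f_in[of v] by auto
    then show "\<phi> v \<in> H"
      unfolding \<phi>_def using h(1) by (rule bij_betwE[rule_format, rotated])
  qed
  have E: "edges G \<subseteq> [verts G]\<^bsup>2\<^esup>"
    using G by (simp add: simple_graph_def)
  define C where "C = \<lparr>verts = \<phi> ` verts G, edges = (`) \<phi> ` edges G,
    vord = Restr (vord (K_ord N)) (\<phi> ` verts G)\<rparr>"
  have EC: "edges C \<subseteq> [\<phi> ` verts G]\<^bsup>2\<^esup>"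
    using E nsets_image_funcset[OF _ inj, of "\<phi> ` verts G" 2]
    by (auto simp: C_def)
  have VH: "\<phi> ` verts G \<subseteq> H"
    using im by auto
  have "vo_subgraph C (K_ord N)"
    using EC VH H nsets_mono[of "\<phi> ` verts G" "{1..N}" 2] G
    by (auto simp: vo_subgraph_def subgraph_def simple_graph_def C_def K_ord_def)
  moreover have "vo_iso \<phi> (vo_graph_of G f) C"
    unfolding vo_iso_def graph_iso_def
  proof (intro conjI ballI)
    show "bij_betw \<phi> (verts (vo_graph_of G f)) (verts C)"
      using inj by (simp add: vo_graph_of_def C_def bij_betw_def)
    fix u v assume "u \<in> verts (vo_graph_of G f)" "v \<in> verts (vo_graph_of G f)"
    then have uv: "u \<in> verts G" "v \<in> verts G"
      by (simp_all add: vo_graph_of_def)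
    \<comment> \<open>No new edge arises under \<open>\<phi>\<close>, since taking images is
      injective on the subsets of \<open>verts G\<close>.\<close>
    have "\<phi> ` {u, v} \<in> (`) \<phi> ` edges G \<longleftrightarrow> {u, v} \<in> edges G"
      using uv E by (intro inj_on_image_mem_iff[OF inj_on_image_Pow[OF inj]]) (auto simp: nsets_def)
    then show "{u, v} \<in> edges (vo_graph_of G f) \<longleftrightarrow> {\<phi> u, \<phi> v} \<in> edges C"
      by (simp add: vo_graph_of_def C_def)
    have "{\<phi> u, \<phi> v} \<subseteq> {1..N}"
      using VH H uv by blast
    then show "(u, v) \<in> vord (vo_graph_of G f) \<longleftrightarrow> (\<phi> u, \<phi> v) \<in> vord C"
      using uv less by (simp add: vo_graph_of_def C_def K_ord_def)
  qed
  ultimately have "vo_copy C (vo_graph_of G f) (K_ord N)"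
    by (auto simp: vo_copy_def)
  moreover have "edges C \<subseteq> [H]\<^bsup>2\<^esup>"
    using EC nsets_mono[OF VH] by blast
  ultimately show ?thesis
    using that by blast
qed

text \<open>A \<open>LEAST\<close> has its defining property only if some number does. The witness
  is a bound forcing a monochromatic clique on \<open>card (verts G)\<close> vertices, inside which
  the ordered graph is placed.\<close>

lemma ordered_ramsey_number_attained:
  assumes "simple_graph G" and "bij_betw f (verts G) {1..card (verts G)}"
  defines "N \<equiv> ordered_ramsey_number (vo_graph_of G f)"
  shows "N > 0 \<and> (\<forall>col :: nat set \<Rightarrow> bool.
    \<exists>C. vo_copy C (vo_graph_of G f) (K_ord N) \<and> monochromatic col C)"
proof -
  obtain M where M: "M > 0"
    "\<And>col :: nat set \<Rightarrow> bool. \<exists>H c. H \<subseteq> {1..M} \<and> card H = card (verts G) \<and> (\<forall>e\<in>[H]\<^bsup>2\<^esup>. col e = c)"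
    using ex_monochromatic_clique by blast
  have "\<exists>C. vo_copy C (vo_graph_of G f) (K_ord M) \<and> monochromatic col C" for col
  proof -
    obtain H c where H: "H \<subseteq> {1..M}" "card H = card (verts G)" "\<forall>e\<in>[H]\<^bsup>2\<^esup>. col e = c"
      using M(2)[of col] by blast
    obtain C where "vo_copy C (vo_graph_of G f) (K_ord M)" "edges C \<subseteq> [H]\<^bsup>2\<^esup>"
      using vo_copy_on_subset[OF assms(1,2) H(1,2)] .
    then show ?thesis
      using H(3) by (auto simp: monochromatic_def)
  qed
  then have "M > 0 \<and> (\<forall>col. \<exists>C. vo_copy C (vo_graph_of G f) (K_ord M) \<and> monochromatic col C)"
    using M(1) by blast
  then show ?thesis
    unfolding N_def ordered_ramsey_number_def by (rule LeastI)
qed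

lemma lex_ramsey_number_le:
  assumes G: "edge_ordered_graph G" and f: "consistent f G"
  shows "lex_ramsey_number G \<le> ordered_ramsey_number (vo_graph_of G f)" (is "_ \<le> ?N")
proof -
  have N: "?N > 0" "\<And>col. \<exists>C. vo_copy C (vo_graph_of G f) (K_ord ?N) \<and> monochromatic col C"
    using ordered_ramsey_number_attained[of G f] G f
    by (auto simp: edge_ordered_graph_def consistent_def)
  have "\<exists>D. eo_copy D G (K_lex ?N) \<and> monochromatic col D" for col
  proof -
    obtain C where "vo_copy C (vo_graph_of G f) (K_ord ?N)" "monochromatic col C"
      using N(2) by blast
    then show ?thesis
      using vo_copy_imp_eo_copy[OF G f] by (fastforce simp: monochromatic_def)
  qed
  then show ?thesis
    unfolding lex_ramsey_number_def by (intro Least_le) (use N(1) in auto)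
qed

theorem lemma4:
  fixes G :: "'a eo_graph"
  assumes "lex_edge_ordered_graph G"
  shows "lex_ramsey_number G \<le> Min {ordered_ramsey_number (vo_graph_of G f) | f. consistent f G}"
proof -
  have G: "edge_ordered_graph G" and ne: "{f. consistent f G} \<noteq> {}"
    using assms by (auto simp: lex_edge_ordered_graph_def)
  \<comment> \<open>Written as an image, the set inherits finiteness and nonemptiness from the
    consistent \<open>f\<close>, so \<open>Min\<close> is a genuine minimum and it suffices to bound
    each member.\<close>
  have "{ordered_ramsey_number (vo_graph_of G f) | f. consistent f G} =
      (\<lambda>f. ordered_ramsey_number (vo_graph_of G f)) ` {f. consistent f G}"
    by auto
  then show ?thesis
    using finite_consistent[OF G] ne lex_ramsey_number_le[OF G] by simp
qed

end
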